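(* Let $F$ be a nonsingular unsatisfiable hitting clause-set which is fs-resolvable, and let $F'$ be the result of an fs-resolution on $F$ (so $F'$ is an unsatisfiable hitting clause-set). Then $\mathrm{singind}(F')\le 3$.
   Context: Variables are positive integers, literals are nonzero integers, the complement of $x$ is $\overline{x}=-x$. A clause is a finite set of literals with no pair $x,\overline{x}$; a clause-set is a finite set of clauses. $F$ is satisfiable if some clause meets every clause of $F$, otherwise unsatisfiable. $F$ is hitting if any two distinct clauses $C,D\in F$ have some $x\in C$ with $\overline{x}\in D$. $\mathrm{ldeg}_F(x)$ is the number of clauses containing $x$; a variable $v$ of $F$ is singular if $\min(\mathrm{ldeg}_F(v),\mathrm{ldeg}_F(\overline v))=1$; $F$ is nonsingular if it has none. For a singular variable $v$, singular DP-reduction replaces $F$ by $\mathrm{DP}_v(F):=\{(A\cup B)\setminus\{v,\overline v\}: A,B\in F, A\cap\overline{B}=\{v\}\}\cup\{A\in F: v \text{ does not occur in } A\}$. For an unsatisfiable hitting clause-set $F$, every maximal sequence of singular DP-reductions (ending when no singular variable remains) has the same length, denoted $\mathrm{singind}(F)$. An fs-pair is $\{E\cup\{w\},E\cup\{\overline w\}\}$ with $w,\overline w\notin E$; $F$ is fs-resolvable if it contains an fs-pair $\{E\cup\{w\},E\cup\{\overline w\}\}$ with $E\notin F$, and the fs-resolution replaces these two clauses by $E$. *)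

theory Defs
  imports Main
begin

text \<open>Literals are the nonzero integers, variables the positive integers, and the complement
  of a literal is its negation.\<close>

definition clause :: "int set \<Rightarrow> bool" where
  "clause C \<longleftrightarrow> finite C \<and> 0 \<notin> C \<and> (\<forall>x\<in>C. - x \<notin> C)"

definition clause_set :: "int set set \<Rightarrow> bool" where
  "clause_set F \<longleftrightarrow> finite F \<and> (\<forall>C\<in>F. clause C)"

definition satisfiable :: "int set set \<Rightarrow> bool" where
  "satisfiable F \<longleftrightarrow> (\<exists>P. clause P \<and> (\<forall>C\<in>F. P \<inter> C \<noteq> {}))"

definition hitting :: "int set set \<Rightarrow> bool" where
  "hitting F \<longleftrightarrow> (\<forall>C\<in>F. \<forall>D\<in>F. C \<noteq> D \<longrightarrow> (\<exists>x\<in>C. - x \<in> D))"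

definition unsat_hitting :: "int set set \<Rightarrow> bool" where
  "unsat_hitting F \<longleftrightarrow> clause_set F \<and> \<not> satisfiable F \<and> hitting F"

definition ldeg :: "int set set \<Rightarrow> int \<Rightarrow> nat" where
  "ldeg F x = card {C \<in> F. x \<in> C}"

text \<open>If the minimum is 1 then \<open>v\<close> occurs in \<open>F\<close>, so this need not be required separately.\<close>

definition singular_var :: "int set set \<Rightarrow> int \<Rightarrow> bool" where
  "singular_var F v \<longleftrightarrow> v > 0 \<and> min (ldeg F v) (ldeg F (- v)) = 1"

definition nonsingular :: "int set set \<Rightarrow> bool" where
  "nonsingular F \<longleftrightarrow> (\<nexists>v. singular_var F v)"

definition DP :: "int \<Rightarrow> int set set \<Rightarrow> int set set" where
  "DP v F = {(A \<union> B) - {v, - v} | A B. A \<in> F \<and> B \<in> F \<and> A \<inter> uminus ` B = {v}}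
            \<union> {A \<in> F. v \<notin> A \<and> - v \<notin> A}"

definition singular_DP :: "int set set \<Rightarrow> int set set \<Rightarrow> bool" where
  "singular_DP F G \<longleftrightarrow> (\<exists>v. singular_var F v \<and> G = DP v F)"

text \<open>The common length of all maximal sequences of singular DP-reductions starting in \<open>F\<close>;
  it is meaningful only when this length is unique, as it is for unsatisfiable hitting
  clause-sets.\<close>

definition singind :: "int set set \<Rightarrow> nat" where
  "singind F = (THE n. \<exists>G. (singular_DP ^^ n) F G \<and> nonsingular G)"

definition fs_pair :: "int set \<Rightarrow> int \<Rightarrow> int set set" where
  "fs_pair E w = {insert w E, insert (- w) E}"

definition fs_resolvable_on :: "int set set \<Rightarrow> int set \<Rightarrow> int \<Rightarrow> bool" where
  "fs_resolvable_on F E w \<longleftrightarrow>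
     clause E \<and> w \<noteq> 0 \<and> w \<notin> E \<and> - w \<notin> E \<and> fs_pair E w \<subseteq> F \<and> E \<notin> F"

definition fs_resolvable :: "int set set \<Rightarrow> bool" where
  "fs_resolvable F \<longleftrightarrow> (\<exists>E w. fs_resolvable_on F E w)"

definition fs_resolution :: "int set set \<Rightarrow> int set set \<Rightarrow> bool" where
  "fs_resolution F F' \<longleftrightarrow>
     (\<exists>E w. fs_resolvable_on F E w \<and> F' = insert E (F - fs_pair E w))"

end

theory Submission
  imports Defs
begin

text \<open>In an unsatisfiable hitting clause-set, if the literal \<open>x\<close> occurs only in the clause \<open>C\<close>, then
  every clause containing \<open>- x\<close> includes \<open>C - {x}\<close>. Hence singular DP-reduction on \<open>x\<close> amounts to
  setting \<open>x\<close> to true, two distinct literals of degree 1 never lie in a common clause, and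
  reductions commute; so all maximal reduction sequences have the same length, and one may be chosen.

  Moreover, setting \<open>x\<close> to true creates no new literal of degree 1 when \<open>- x\<close> has degree at least 2.
  After the fs-resolution, \<open>E\<close> contains at most one literal of degree 1, which is eliminated first;
  then only \<open>w\<close> and \<open>- w\<close> can have degree 1. If both have, eliminating them is again an fs-resolution,
  after which at most one literal of degree 1 is left, and its elimination creates no further one.\<close>

section \<open>Unsatisfiable hitting clause-sets\<close>

lemma unsat_hittingD:
  assumes "unsat_hitting F"
  shows "finite F" "\<And>C. C \<in> F \<Longrightarrow> clause C"
    "\<And>C D. C \<in> F \<Longrightarrow> D \<in> F \<Longrightarrow> C \<noteq> D \<Longrightarrow> \<exists>x\<in>C. - x \<in> D"
    "\<And>P. clause P \<Longrightarrow> \<exists>B\<in>F. P \<inter> B = {}"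
  using assms unfolding unsat_hitting_def clause_set_def hitting_def satisfiable_def by blast+

lemma ldeg_pos_iff:
  assumes "finite F"
  shows "ldeg F x > 0 \<longleftrightarrow> (\<exists>C\<in>F. x \<in> C)"
  using assms by (auto simp: ldeg_def card_gt_0_iff)

lemma ldeg_eq_1E:
  assumes "ldeg F x = 1"
  obtains C where "C \<in> F" "x \<in> C" "\<And>D. D \<in> F \<Longrightarrow> x \<in> D \<Longrightarrow> D = C"
proof -
  from assms obtain C where "{C \<in> F. x \<in> C} = {C}"
    unfolding ldeg_def by (metis card_1_singletonE)
  then show thesis using that[of C] by blast
qed

text \<open>Flip \<open>C\<close> at \<open>x\<close>: \<open>P\<close> makes \<open>x\<close> true
  and falsifies the rest of \<open>C\<close>. A clause \<open>B\<close> missed by \<open>P\<close>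
  differs from \<open>C\<close>, and its clash with \<open>C\<close> can only be at
  \<open>- x\<close>.\<close>

lemma complement_occurs:
  assumes F: "unsat_hitting F" and C: "C \<in> F" "x \<in> C"
  obtains D where "D \<in> F" "- x \<in> D"
proof -
  define P where "P = insert x (uminus ` (C - {x}))"
  have "clause C" using F C unsat_hittingD by blast
  then have "clause P" using C unfolding P_def clause_def by force
  then obtain B where B: "B \<in> F" "P \<inter> B = {}" using F unsat_hittingD by blast
  then have "B \<noteq> C" using C unfolding P_def by blast
  then obtain l where l: "l \<in> B" "- l \<in> C" using F C B unsat_hittingD by blast
  have "- l = x"
  proof (rule ccontr)
    assume "- l \<noteq> x"
    then have "l \<in> P" unfolding P_def using l by force
    then show False using l B by blast
  qed
  then have "- x \<in> B" using l by force
  then show thesis using that B by blast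
qed

text \<open>Otherwise the assignment that falsifies \<open>D - {- x}\<close> and sets both \<open>- x\<close> and some
  \<open>z \<in> C - {x} - D\<close> to true satisfies \<open>F\<close>.\<close>

lemma singular_clause_subset:
  assumes F: "unsat_hitting F" and deg: "ldeg F x = 1"
    and C: "C \<in> F" "x \<in> C" and D: "D \<in> F" "- x \<in> D"
  shows "C - {x} \<subseteq> D"
proof
  fix z assume z: "z \<in> C - {x}"
  show "z \<in> D"
  proof (rule ccontr)
    assume "z \<notin> D"
    define P where "P = {- x, z} \<union> uminus ` (D - {- x})"
    have cl: "clause C" "clause D" using F C D unsat_hittingD by blast+
    have "clause P" unfolding clause_def
    proof (intro conjI ballI)
      show "finite P" "0 \<notin> P" using cl z D unfolding P_def clause_def by force+
      fix l assume "l \<in> P"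
      then show "- l \<notin> P" using cl z D C \<open>z \<notin> D\<close> unfolding P_def clause_def by force
    qed
    then obtain B where B: "B \<in> F" "P \<inter> B = {}" using F unsat_hittingD by blast
    have "x \<notin> B"
    proof
      assume "x \<in> B"
      then have "B = C" using deg B C by (metis ldeg_eq_1E)
      then show False using B z unfolding P_def by blast
    qed
    have "B \<noteq> D" using B D unfolding P_def by blast
    then obtain l where l: "l \<in> B" "- l \<in> D" using F D B unsat_hittingD by blast
    have "l \<noteq> x" using l \<open>x \<notin> B\<close> by blast
    then have "l \<in> P" unfolding P_def using l by force
    then show False using l B by blast
  qed
qed

text \<open>Otherwise \<open>y\<close> lies in every clause containing \<open>- x\<close>; such a
  clause must then be the only clause \<open>C\<close> of \<open>y\<close>, which already contains
  \<open>x\<close>.\<close>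

lemma singular_literal_unique:
  assumes F: "unsat_hitting F" and "C \<in> F" "x \<in> C" "y \<in> C" "ldeg F x = 1" "ldeg F y = 1"
  shows "x = y"
proof (rule ccontr)
  assume "x \<noteq> y"
  obtain D where D: "D \<in> F" "- x \<in> D" using complement_occurs assms by blast
  then have "y \<in> D" using singular_clause_subset[OF F] assms \<open>x \<noteq> y\<close> by blast
  then have "D = C" using D assms by (metis ldeg_eq_1E)
  then show False using D assms unsat_hittingD(2)[OF F] unfolding clause_def by blast
qed

text \<open>A remaining clause clashes with both members of the pair; as it cannot contain both
  \<open>w\<close> and \<open>- w\<close>, one of these clashes is with \<open>E\<close>. An
  assignment that meets \<open>E\<close> meets both members of the pair.\<close>

lemma fs_resolution_unsat_hitting:
  assumes F: "unsat_hitting F" and fs: "fs_resolvable_on F E w"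
  shows "unsat_hitting (insert E (F - fs_pair E w))"
proof -
  note fs = fs[unfolded fs_resolvable_on_def fs_pair_def]
  have clash: "\<exists>x\<in>B. - x \<in> E" if B: "B \<in> F - fs_pair E w" for B
  proof -
    have "clause B" using B F unsat_hittingD by blast
    obtain l where l: "l \<in> B" "- l \<in> insert w E"
      using unsat_hittingD(3)[OF F, of B "insert w E"] B fs unfolding fs_pair_def by blast
    obtain m where m: "m \<in> B" "- m \<in> insert (- w) E"
      using unsat_hittingD(3)[OF F, of B "insert (- w) E"] B fs unfolding fs_pair_def by blast
    show ?thesis
      using l m \<open>clause B\<close> unfolding clause_def by (metis insert_iff minus_minus)
  qed
  have clash': "\<exists>x\<in>E. - x \<in> B" if B: "B \<in> F - fs_pair E w" for B
    using clash[OF B] by (metis minus_minus)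
  have "\<not> satisfiable (insert E (F - fs_pair E w))"
  proof
    assume "satisfiable (insert E (F - fs_pair E w))"
    then obtain P where P: "clause P" "P \<inter> E \<noteq> {}" "\<forall>C\<in>F - fs_pair E w. P \<inter> C \<noteq> {}"
      unfolding satisfiable_def by blast
    have "\<forall>C\<in>F. P \<inter> C \<noteq> {}" using P unfolding fs_pair_def by blast
    then show False using P F unfolding unsat_hitting_def satisfiable_def by blast
  qed
  moreover have "clause_set (insert E (F - fs_pair E w))"
    using F fs unfolding unsat_hitting_def clause_set_def by blast
  moreover have "hitting (insert E (F - fs_pair E w))"
    unfolding hitting_def using clash clash' unsat_hittingD(3)[OF F] by blast
  ultimately show ?thesis unfolding unsat_hitting_def by blast
qed

section \<open>Singular DP-reduction as an assignment\<close>

text \<open>The usual restriction by the partial assignment that makes \<open>x\<close> true,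
  available for every literal and not only for those of degree 1.\<close>

definition assign :: "int \<Rightarrow> int set set \<Rightarrow> int set set" where
  "assign x F = (\<lambda>D. D - {- x}) ` {D \<in> F. x \<notin> D}"

text \<open>Neither clause contains \<open>x\<close>, so a clash of two clauses survives the removal
  of \<open>- x\<close>, which is impossible if the results coincide. Thus degrees after an
  assignment can be counted in \<open>F\<close>.\<close>

lemma inj_on_assign:
  assumes F: "unsat_hitting F"
  shows "inj_on (\<lambda>D. D - {- x}) {D \<in> F. x \<notin> D}"
proof (rule inj_onI, rule ccontr)
  fix A B assume A: "A \<in> {D \<in> F. x \<notin> D}" and B: "B \<in> {D \<in> F. x \<notin> D}"
    and eq: "A - {- x} = B - {- x}" and "A \<noteq> B"
  then obtain l where l: "l \<in> A" "- l \<in> B" using unsat_hittingD(3)[OF F] by blast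
  have "l \<noteq> - x" using l B by auto
  then have "l \<in> B" using l eq by blast
  then show False using l B unsat_hittingD(2)[OF F] unfolding clause_def by blast
qed

lemma ldeg_assign:
  assumes F: "unsat_hitting F" and "y \<noteq> - x"
  shows "ldeg (assign x F) y = card {D \<in> F. x \<notin> D \<and> y \<in> D}"
proof -
  have "{C \<in> assign x F. y \<in> C} = (\<lambda>D. D - {- x}) ` {D \<in> F. x \<notin> D \<and> y \<in> D}"
    using assms(2) unfolding assign_def by auto
  moreover have "inj_on (\<lambda>D. D - {- x}) {D \<in> F. x \<notin> D \<and> y \<in> D}"
    using inj_on_assign[OF F] by (rule inj_on_subset) auto
  ultimately show ?thesis unfolding ldeg_def by (simp add: card_image)
qed

lemma ldeg_assign_self: "ldeg (assign x F) (- x) = 0" "ldeg (assign x F) x = 0"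
proof -
  have "{C \<in> assign x F. - x \<in> C} = {}" "{C \<in> assign x F. x \<in> C} = {}"
    unfolding assign_def by auto
  then show "ldeg (assign x F) (- x) = 0" "ldeg (assign x F) x = 0"
    unfolding ldeg_def by (metis card.empty)+
qed

text \<open>The assignment drops only the clause \<open>C\<close>, so a literal outside
  \<open>C\<close> loses no occurrence.\<close>

lemma ldeg_assign_unchanged:
  assumes F: "unsat_hitting F" and "ldeg F x = 1" "C \<in> F" "x \<in> C" "y \<notin> C" "y \<noteq> - x"
  shows "ldeg (assign x F) y = ldeg F y"
proof -
  have "x \<notin> D" if "D \<in> F" "y \<in> D" for D
    using that assms by (metis ldeg_eq_1E)
  then have "{D \<in> F. x \<notin> D \<and> y \<in> D} = {D \<in> F. y \<in> D}" by blast
  then show ?thesis using ldeg_assign[OF F] assms unfolding ldeg_def by simp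
qed

text \<open>A satisfying assignment of the restriction, overridden at \<open>x\<close>, would
  satisfy \<open>F\<close>. Clashes survive because the clauses that are kept do not contain
  \<open>x\<close>.\<close>

lemma assign_unsat_hitting:
  assumes F: "unsat_hitting F" and "x \<noteq> 0"
  shows "unsat_hitting (assign x F)"
proof -
  have "\<not> satisfiable (assign x F)"
  proof
    assume "satisfiable (assign x F)"
    then obtain P where P: "clause P" "\<forall>D\<in>assign x F. P \<inter> D \<noteq> {}"
      unfolding satisfiable_def by blast
    define Q where "Q = insert x (P - {- x})"
    have "clause Q" using P \<open>x \<noteq> 0\<close> unfolding Q_def clause_def by auto
    then obtain B where B: "B \<in> F" "Q \<inter> B = {}" using F unsat_hittingD by blast
    then have "B - {- x} \<in> assign x F" unfolding assign_def Q_def by blast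
    then have "P \<inter> (B - {- x}) \<noteq> {}" using P by blast
    then show False using B unfolding Q_def by blast
  qed
  moreover have "clause_set (assign x F)"
    using F unfolding unsat_hitting_def clause_set_def assign_def clause_def by auto
  moreover have "hitting (assign x F)"
    unfolding hitting_def
  proof (intro ballI impI)
    fix C D assume "C \<in> assign x F" "D \<in> assign x F" "C \<noteq> D"
    then obtain A B where AB: "A \<in> F" "x \<notin> A" "B \<in> F" "x \<notin> B"
      "C = A - {- x}" "D = B - {- x}" unfolding assign_def by blast
    then obtain l where l: "l \<in> A" "- l \<in> B"
      using \<open>C \<noteq> D\<close> unsat_hittingD(3)[OF F, of A B] by blast
    have "l \<noteq> - x" "- l \<noteq> - x" using l AB by auto
    then show "\<exists>x\<in>C. - x \<in> D" using l AB by blast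
  qed
  ultimately show ?thesis unfolding unsat_hitting_def by blast
qed

lemma singular_literal_nonzero:
  assumes F: "unsat_hitting F" and "ldeg F x = 1"
  shows "x \<noteq> 0"
proof -
  obtain C where "C \<in> F" "x \<in> C" using assms(2) by (rule ldeg_eq_1E)
  then show ?thesis using unsat_hittingD(2)[OF F] unfolding clause_def by blast
qed

text \<open>Exchanging the two parent clauses exchanges \<open>v\<close> and \<open>- v\<close>.
  This makes it possible to reduce on negative literals.\<close>

lemma DP_uminus: "DP (- v) F = DP v F"
proof -
  have swap: "A \<inter> uminus ` B = {- u} \<longleftrightarrow> B \<inter> uminus ` A = {u}" for A B :: "int set" and u
  proof -
    have "B \<inter> uminus ` A = uminus ` (A \<inter> uminus ` B)"
      by (force simp: image_iff)
    then show ?thesis by (metis image_empty image_insert inj_image_eq_iff inj_uminus minus_minus)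
  qed
  show ?thesis unfolding DP_def swap by (auto simp: Un_commute insert_commute)
qed

text \<open>As \<open>C - {x}\<close> is contained in every \<open>D\<close> with
  \<open>- x\<close>, the two clauses clash only at \<open>x\<close>, and their resolvent is
  \<open>D - {- x}\<close>.\<close>

lemma DP_singular_literal:
  assumes F: "unsat_hitting F" and deg: "ldeg F x = 1"
  shows "DP x F = assign x F"
proof -
  obtain C where C: "C \<in> F" "x \<in> C" and uniq: "\<And>D. D \<in> F \<Longrightarrow> x \<in> D \<Longrightarrow> D = C"
    using deg by (metis ldeg_eq_1E)
  have res: "C \<inter> uminus ` D = {x} \<and> (C \<union> D) - {x, - x} = D - {- x} \<and> x \<notin> D"
    if D: "D \<in> F" "- x \<in> D" for D
  proof -
    have cl: "clause C" "clause D" using F C D unsat_hittingD by blast+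
    have sub: "C - {x} \<subseteq> D" using singular_clause_subset[OF F deg C D] .
    have "x \<notin> D" using cl D unfolding clause_def by force
    moreover have "C \<inter> uminus ` D = {x}"
    proof
      show "C \<inter> uminus ` D \<subseteq> {x}" using sub cl unfolding clause_def by force
      show "{x} \<subseteq> C \<inter> uminus ` D" using C D by (force simp: image_iff)
    qed
    ultimately show ?thesis using sub by blast
  qed
  have "{(A \<union> B) - {x, - x} | A B. A \<in> F \<and> B \<in> F \<and> A \<inter> uminus ` B = {x}}
      = {D - {- x} | D. D \<in> F \<and> - x \<in> D}" (is "?L = ?R")
  proof
    show "?L \<subseteq> ?R"
    proof
      fix K assume "K \<in> ?L"
      then obtain A B where K: "K = (A \<union> B) - {x, - x}"
        and AB: "A \<in> F" "B \<in> F" "A \<inter> uminus ` B = {x}" by blast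
      then have "x \<in> A" "x \<in> uminus ` B" by blast+
      then have "- x \<in> B" by auto
      have "A = C" using uniq AB(1) \<open>x \<in> A\<close> by blast
      then show "K \<in> ?R" using res[OF AB(2) \<open>- x \<in> B\<close>] K AB(2) \<open>- x \<in> B\<close> by blast
    qed
    show "?R \<subseteq> ?L"
    proof
      fix K assume "K \<in> ?R"
      then obtain D where D: "K = D - {- x}" "D \<in> F" "- x \<in> D" by blast
      then have "K = (C \<union> D) - {x, - x}" "C \<inter> uminus ` D = {x}" using res by blast+
      then show "K \<in> ?L" using C D by blast
    qed
  qed
  then have "DP x F = ?R \<union> {A \<in> F. x \<notin> A \<and> - x \<notin> A}" unfolding DP_def by simp
  also have "\<dots> = assign x F"
  proof -
    have "{D \<in> F. x \<notin> D} = {D \<in> F. - x \<in> D} \<union> {A \<in> F. x \<notin> A \<and> - x \<notin> A}"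
      using res by blast
    moreover have "(\<lambda>D. D - {- x}) ` {D \<in> F. - x \<in> D} = ?R" by blast
    moreover have "(\<lambda>D. D - {- x}) ` {A \<in> F. x \<notin> A \<and> - x \<notin> A} = {A \<in> F. x \<notin> A \<and> - x \<notin> A}"
      by (simp cong: image_cong_simp)
    ultimately show ?thesis unfolding assign_def by (simp only: image_Un)
  qed
  finally show ?thesis .
qed

text \<open>The minimum could differ from 1 only if the complementary literal had degree 0, which
  \<open>complement_occurs\<close> excludes.\<close>

lemma singular_var_iff:
  assumes F: "unsat_hitting F"
  shows "singular_var F v \<longleftrightarrow> v > 0 \<and> (ldeg F v = 1 \<or> ldeg F (- v) = 1)"
proof -
  have "ldeg F (- x) > 0" if "ldeg F x > 0" for x
    using that complement_occurs[OF F] unsat_hittingD(1)[OF F] by (metis ldeg_pos_iff)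
  from this[of v] this[of "- v"] show ?thesis
    unfolding singular_var_def by (auto simp: min_def)
qed

lemma singular_DP_iff:
  assumes F: "unsat_hitting F"
  shows "singular_DP F G \<longleftrightarrow> (\<exists>x. ldeg F x = 1 \<and> G = assign x F)"
proof
  assume "singular_DP F G"
  then obtain v where v: "ldeg F v = 1 \<or> ldeg F (- v) = 1" "G = DP v F"
    unfolding singular_DP_def singular_var_iff[OF F] by blast
  then show "\<exists>x. ldeg F x = 1 \<and> G = assign x F"
    using DP_singular_literal[OF F] DP_uminus by metis
next
  assume "\<exists>x. ldeg F x = 1 \<and> G = assign x F"
  then obtain x where x: "ldeg F x = 1" "G = assign x F" by blast
  have "x \<noteq> 0" using singular_literal_nonzero[OF F x(1)] .
  have G: "G = DP x F" using DP_singular_literal[OF F] x by simp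
  show "singular_DP F G"
  proof (cases "x > 0")
    case True
    then show ?thesis using x G singular_var_iff[OF F] unfolding singular_DP_def by blast
  next
    case False
    then have "singular_var F (- x)" using x \<open>x \<noteq> 0\<close> singular_var_iff[OF F] by simp
    then show ?thesis using G DP_uminus unfolding singular_DP_def by metis
  qed
qed

lemma nonsingular_iff:
  assumes F: "unsat_hitting F"
  shows "nonsingular F \<longleftrightarrow> (\<forall>x. ldeg F x \<noteq> 1)"
proof -
  have "nonsingular F \<longleftrightarrow> (\<nexists>G. singular_DP F G)"
    unfolding nonsingular_def singular_DP_def by blast
  then show ?thesis unfolding singular_DP_iff[OF F] by blast
qed

lemma singular_DP_unsat_hitting:
  assumes "unsat_hitting F" "singular_DP F G"
  shows "unsat_hitting G"
  using assms assign_unsat_hitting singular_DP_iff singular_literal_nonzero by metis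

section \<open>Confluence\<close>

text \<open>The inclusion \<open>singular_clause_subset\<close> applies in both directions, so the
  two clauses form an fs-pair.\<close>

lemma assign_both_singular_clause:
  assumes F: "unsat_hitting F" and x: "ldeg F x = 1" "ldeg F (- x) = 1"
    and C: "C \<in> F" "x \<in> C" and D: "D \<in> F" "- x \<in> D"
  shows "C - {x} = D - {- x}"
proof -
  have "C - {x} \<subseteq> D" "D - {- x} \<subseteq> C"
    using singular_clause_subset[OF F x(1) C D] singular_clause_subset[OF F x(2) D] C by simp_all
  moreover have "clause C" "clause D" using unsat_hittingD(2)[OF F] C D by blast+
  then have "- x \<notin> C" "x \<notin> D" using C D unfolding clause_def by force+
  ultimately show ?thesis by blast
qed

text \<open>Either assignment drops one member of the fs-pair and shortens the other to the same
  clause. This settles complementary literals in the diamond property.\<close>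

lemma assign_both_singular:
  assumes F: "unsat_hitting F" and x: "ldeg F x = 1" "ldeg F (- x) = 1"
  shows "assign x F = assign (- x) F"
proof -
  have sub: "assign y F \<subseteq> assign (- y) F" if y: "ldeg F y = 1" "ldeg F (- y) = 1" for y
  proof
    fix K assume "K \<in> assign y F"
    then obtain D where D: "D \<in> F" "y \<notin> D" "K = D - {- y}" unfolding assign_def by blast
    show "K \<in> assign (- y) F"
    proof (cases "- y \<in> D")
      case True
      obtain C where C: "C \<in> F" "y \<in> C" using y by (metis ldeg_eq_1E)
      then have "K = C - {y}" using assign_both_singular_clause[OF F y C D(1) True] D by simp
      moreover have "- y \<notin> C" using C unsat_hittingD(2)[OF F] unfolding clause_def by blast
      ultimately show ?thesis using C unfolding assign_def by auto
    next
      case False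
      then show ?thesis using D unfolding assign_def by force
    qed
  qed
  show ?thesis using sub[of x] sub[of "- x"] x by simp
qed

lemma assign_commute:
  assumes "x \<noteq> - y"
  shows "assign x (assign y F) = assign y (assign x F)"
proof -
  have eq: "assign u (assign v F) = (\<lambda>D. D - {- u, - v}) ` {D \<in> F. u \<notin> D \<and> v \<notin> D}"
    if "u \<noteq> - v" for u v
  proof -
    \<comment> \<open>Since \<open>u\<close> is not \<open>- v\<close>, removing \<open>- v\<close>
      never deletes \<open>u\<close>, so the clauses may be filtered first.\<close>
    have "{D \<in> assign v F. u \<notin> D} = (\<lambda>D. D - {- v}) ` {D \<in> F. u \<notin> D \<and> v \<notin> D}"
      using that unfolding assign_def by blast
    moreover have "D - {- v} - {- u} = D - {- u, - v}" for D by blast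
    ultimately show ?thesis unfolding assign_def[of u] by (simp add: image_image)
  qed
  have "y \<noteq> - x" using assms by auto
  from eq[OF assms] eq[OF this] show ?thesis by (simp add: insert_commute conj_commute)
qed

text \<open>As the results differ, \<open>x\<close> and \<open>y\<close> are neither equal nor
  complementary. They share no clause, so each keeps degree 1 when the other is assigned, and the
  assignments commute.\<close>

lemma singular_DP_diamond:
  assumes F: "unsat_hitting F" and "singular_DP F G" "singular_DP F H" "G \<noteq> H"
  obtains K where "singular_DP G K" "singular_DP H K"
proof -
  obtain x where x: "ldeg F x = 1" "G = assign x F"
    using assms(2) unfolding singular_DP_iff[OF F] by blast
  obtain y where y: "ldeg F y = 1" "H = assign y F"
    using assms(3) unfolding singular_DP_iff[OF F] by blast
  have "x \<noteq> y" using x(2) y(2) assms(4) by blast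
  have "x \<noteq> - y"
  proof
    assume "x = - y"
    then show False using x y assms(4) assign_both_singular[OF F y(1)] by simp
  qed
  then have "y \<noteq> - x" by auto
  obtain C where C: "C \<in> F" "x \<in> C" using x by (metis ldeg_eq_1E)
  obtain D where D: "D \<in> F" "y \<in> D" using y by (metis ldeg_eq_1E)
  have "y \<notin> C" using singular_literal_unique[OF F C] x(1) y(1) \<open>x \<noteq> y\<close> by blast
  then have Gy: "ldeg G y = 1"
    using ldeg_assign_unchanged[OF F x(1) C] \<open>y \<noteq> - x\<close> x(2) y(1) by simp
  have "x \<notin> D" using singular_literal_unique[OF F D] x(1) y(1) \<open>x \<noteq> y\<close> by blast
  then have Hx: "ldeg H x = 1"
    using ldeg_assign_unchanged[OF F y(1) D] \<open>x \<noteq> - y\<close> y(2) x(1) by simp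
  have "unsat_hitting G" "unsat_hitting H"
    using singular_DP_unsat_hitting[OF F] assms(2,3) by blast+
  then have "singular_DP G (assign y G)" "singular_DP H (assign x H)"
    using singular_DP_iff Gy Hx by blast+
  moreover have "assign y G = assign x H" using x y assign_commute[OF \<open>y \<noteq> - x\<close>] by simp
  ultimately show thesis using that by simp
qed

text \<open>By the diamond property, any available first step can begin a sequence of the same
  length with the same end.\<close>

lemma relpowp_singular_DP_step:
  assumes "unsat_hitting F" "(singular_DP ^^ n) F G" "nonsingular G" "singular_DP F H"
  shows "\<exists>m. n = Suc m \<and> (singular_DP ^^ m) H G"
  using assms
proof (induction n arbitrary: F H)
  case 0
  then show ?case unfolding singular_DP_def nonsingular_def by auto
next
  case (Suc k)
  obtain F1 where F1: "singular_DP F F1" "(singular_DP ^^ k) F1 G"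
    using Suc.prems(2) by (metis relpowp_Suc_E2)
  show ?case
  proof (cases "F1 = H")
    case True
    then show ?thesis using F1 by blast
  next
    case False
    obtain K where K: "singular_DP F1 K" "singular_DP H K"
      using singular_DP_diamond[OF Suc.prems(1) F1(1) Suc.prems(4) False] by blast
    have "unsat_hitting F1" using singular_DP_unsat_hitting Suc.prems(1) F1 by blast
    then obtain j where "k = Suc j" "(singular_DP ^^ j) K G"
      using Suc.IH F1 K Suc.prems(3) by blast
    then show ?thesis using K by (metis relpowp_Suc_I2)
  qed
qed

lemma singular_DP_length_unique:
  assumes "unsat_hitting F" "(singular_DP ^^ n) F G" "nonsingular G"
    "(singular_DP ^^ m) F H" "nonsingular H"
  shows "n = m"
  using assms
proof (induction m arbitrary: F n)
  case 0
  then have "\<not> singular_DP F K" for K unfolding nonsingular_def singular_DP_def by auto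
  then show ?case using 0(2) by (cases n) (auto dest: relpowp_Suc_D2 simp del: relpowp.simps)
next
  case (Suc m)
  obtain F1 where F1: "singular_DP F F1" "(singular_DP ^^ m) F1 H"
    using Suc.prems(4) by (metis relpowp_Suc_E2)
  then obtain k where "n = Suc k" "(singular_DP ^^ k) F1 G"
    using relpowp_singular_DP_step Suc.prems by blast
  moreover have "unsat_hitting F1" using singular_DP_unsat_hitting Suc.prems(1) F1 by blast
  ultimately show ?case using Suc.IH F1 Suc.prems by blast
qed

lemma singind_eqI:
  assumes "unsat_hitting F" "(singular_DP ^^ n) F G" "nonsingular G"
  shows "singind F = n"
  unfolding singind_def using assms singular_DP_length_unique by (intro the_equality) blast+

lemma singind_nonsingular:
  assumes "unsat_hitting F" "nonsingular F"
  shows "singind F = 0"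
  using assms by (intro singind_eqI) auto

text \<open>Each step loses the clause of the eliminated literal. With uniqueness of the length,
  this makes the \<open>THE\<close> in \<open>singind\<close> well defined.\<close>

lemma singular_DP_terminates:
  assumes "unsat_hitting F"
  shows "\<exists>n G. (singular_DP ^^ n) F G \<and> nonsingular G"
  using assms
proof (induction "card F" arbitrary: F rule: less_induct)
  case less
  show ?case
  proof (cases "nonsingular F")
    case True
    then have "(singular_DP ^^ 0) F F \<and> nonsingular F" by simp
    then show ?thesis by blast
  next
    case False
    then obtain x where x: "ldeg F x = 1" using nonsingular_iff less.prems by blast
    then obtain C where C: "C \<in> F" "x \<in> C" by (metis ldeg_eq_1E)
    have F1: "singular_DP F (assign x F)" using x singular_DP_iff less.prems by blast
    have "finite F" using unsat_hittingD less.prems by blast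
    have "card (assign x F) \<le> card {D \<in> F. x \<notin> D}"
      unfolding assign_def using \<open>finite F\<close> by (simp add: card_image_le)
    also have "\<dots> < card F" using C \<open>finite F\<close> by (intro psubset_card_mono) auto
    finally obtain n G where "(singular_DP ^^ n) (assign x F) G" "nonsingular G"
      using less.hyps singular_DP_unsat_hitting[OF less.prems F1] by blast
    then show ?thesis using F1 by (metis relpowp_Suc_I2)
  qed
qed

text \<open>The index may be computed along any chosen reduction; the bounds below rely on this
  freedom.\<close>

lemma singind_assign:
  assumes F: "unsat_hitting F" and x: "ldeg F x = 1"
  shows "singind F = Suc (singind (assign x F))"
proof -
  have step: "singular_DP F (assign x F)" using x singular_DP_iff[OF F] by blast
  then have F1: "unsat_hitting (assign x F)" using singular_DP_unsat_hitting[OF F] by blast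
  then obtain n G where "(singular_DP ^^ n) (assign x F) G" "nonsingular G"
    using singular_DP_terminates by blast
  then have "singind (assign x F) = n" "singind F = Suc n"
    using singind_eqI[OF F1] singind_eqI[OF F] step by (metis relpowp_Suc_I2)+
  then show ?thesis by simp
qed

section \<open>Bounding the singularity index\<close>

text \<open>A literal \<open>y\<close> in the clause of \<open>x\<close> lies in every clause
  containing \<open>- x\<close>, of which there are at least two, so it keeps degree at least 2.
  Outside that clause degrees do not change.\<close>

lemma singular_after_assign:
  assumes F: "unsat_hitting F" and x: "ldeg F x = 1" "ldeg F (- x) \<noteq> 1"
    and y: "ldeg (assign x F) y = 1"
  shows "ldeg F y = 1 \<and> y \<noteq> x \<and> y \<noteq> - x"
proof -
  have ne: "y \<noteq> - x" "y \<noteq> x" using y ldeg_assign_self[of x F] by auto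
  obtain C where C: "C \<in> F" "x \<in> C" using x by (metis ldeg_eq_1E)
  have fin: "finite F" using unsat_hittingD F by blast
  have "y \<notin> C"
  proof
    assume "y \<in> C"
    have "{D \<in> F. - x \<in> D} \<subseteq> {D \<in> F. x \<notin> D \<and> y \<in> D}"
    proof
      fix D assume D: "D \<in> {D \<in> F. - x \<in> D}"
      then have "clause D" using unsat_hittingD(2)[OF F] by blast
      then show "D \<in> {D \<in> F. x \<notin> D \<and> y \<in> D}"
        using D singular_clause_subset[OF F x(1) C] \<open>y \<in> C\<close> ne unfolding clause_def by auto
    qed
    then have "ldeg F (- x) \<le> ldeg (assign x F) y"
      unfolding ldeg_assign[OF F ne(1)] unfolding ldeg_def using fin by (intro card_mono) auto
    moreover have "ldeg F (- x) > 0"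
      using complement_occurs[OF F C] ldeg_pos_iff[OF fin] by metis
    ultimately show False using x y by simp
  qed
  then show ?thesis using ldeg_assign_unchanged[OF F x(1) C] ne y by simp
qed

lemma singind_le_1:
  assumes F: "unsat_hitting F" and x: "ldeg F (- x) \<noteq> 1" and only: "\<And>y. ldeg F y = 1 \<Longrightarrow> y = x"
  shows "singind F \<le> 1"
proof (cases "ldeg F x = 1")
  case True
  then have "unsat_hitting (assign x F)"
    using assign_unsat_hitting[OF F] singular_literal_nonzero[OF F] by blast
  moreover have "ldeg (assign x F) y \<noteq> 1" for y
    using singular_after_assign[OF F True x] only by blast
  ultimately have "singind (assign x F) = 0"
    using singind_nonsingular nonsingular_iff by blast
  then show ?thesis using singind_assign[OF F True] by simp
next
  case False
  then have "nonsingular F" using only nonsingular_iff[OF F] by blast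
  then show ?thesis using singind_nonsingular[OF F] by simp
qed

text \<open>Only if both \<open>w\<close> and \<open>- w\<close> have degree 1 can an elimination
  create new literals of degree 1. These all lie in the single clause \<open>C - {w}\<close> of
  \<open>G\<close>, so there is at most one.\<close>

lemma singind_le_2:
  assumes F: "unsat_hitting F" and only: "\<And>y. ldeg F y = 1 \<Longrightarrow> y = w \<or> y = - w"
  shows "singind F \<le> 2"
proof (cases "ldeg F w = 1 \<and> ldeg F (- w) = 1")
  case True
  then have w: "ldeg F w = 1" "ldeg F (- w) = 1" by auto
  define G where "G = assign w F"
  have G: "unsat_hitting G" unfolding G_def
    using assign_unsat_hitting[OF F] singular_literal_nonzero[OF F w(1)] by blast
  obtain C where C: "C \<in> F" "w \<in> C" using w by (metis ldeg_eq_1E)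
  obtain D where D: "D \<in> F" "- w \<in> D" using w by (metis ldeg_eq_1E)
  have "w \<notin> D" using D unsat_hittingD(2)[OF F] unfolding clause_def by force
  then have "D - {- w} \<in> G" unfolding G_def assign_def using D by blast
  then have CG: "C - {w} \<in> G" using assign_both_singular_clause[OF F w C D] by simp
  have inC: "y \<in> C - {w}" if "ldeg G y = 1" for y
  proof -
    have ne: "y \<noteq> w" "y \<noteq> - w" using that ldeg_assign_self[of w F] unfolding G_def by auto
    then have "ldeg F y \<noteq> 1" using only by blast
    then show ?thesis
      using that ne ldeg_assign_unchanged[OF F w(1) C, of y] unfolding G_def by auto
  qed
  have "singind G \<le> 1"
  proof (cases "\<exists>y. ldeg G y = 1")
    case True
    then obtain y where y: "ldeg G y = 1" by blast
    then have "y \<in> C - {w}" using inC by blast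
    moreover have "clause (C - {w})" using CG unsat_hittingD(2)[OF G] by blast
    \<comment> \<open>Degree 1 would put \<open>- y\<close> into the same clause as
      \<open>y\<close>.\<close>
    ultimately have "ldeg G (- y) \<noteq> 1" using inC unfolding clause_def by blast
    moreover have "z = y" if "ldeg G z = 1" for z
      using singular_literal_unique[OF G CG] inC that y by blast
    ultimately show ?thesis using singind_le_1[OF G] by blast
  next
    case False
    then show ?thesis using nonsingular_iff[OF G] singind_nonsingular[OF G] by simp
  qed
  then show ?thesis using singind_assign[OF F w(1)] unfolding G_def by simp
next
  case False
  \<comment> \<open>One of \<open>w\<close> and \<open>- w\<close> does not have degree 1; the other
    one serves as \<open>x\<close> in \<open>singind_le_1\<close>.\<close>
  then have "singind F \<le> 1"
    using only singind_le_1[OF F, of w] singind_le_1[OF F, of "- w"] by fastforce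
  then show ?thesis by simp
qed

lemma ldeg_fs_resolution_unchanged:
  assumes "y \<notin> E" "y \<noteq> w" "y \<noteq> - w"
  shows "ldeg (insert E (F - fs_pair E w)) y = ldeg F y"
proof -
  have "{C \<in> insert E (F - fs_pair E w). y \<in> C} = {C \<in> F. y \<in> C}"
    using assms unfolding fs_pair_def by blast
  then show ?thesis unfolding ldeg_def by simp
qed

lemma singind_fs_resolution_le_3:
  assumes F: "unsat_hitting F" and ns: "nonsingular F" and fs: "fs_resolvable_on F E w"
  shows "singind (insert E (F - fs_pair E w)) \<le> 3"
proof -
  define G where "G = insert E (F - fs_pair E w)"
  have G: "unsat_hitting G" unfolding G_def using fs_resolution_unsat_hitting[OF F fs] .
  have EG: "E \<in> G" unfolding G_def by blast
  have fs': "clause E" "w \<notin> E" "- w \<notin> E" using fs unfolding fs_resolvable_on_def by blast+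
  \<comment> \<open>\<open>F\<close> has no literal of degree 1, so the degree of \<open>y\<close>
    must have changed.\<close>
  have deg: "y \<in> E \<or> y = w \<or> y = - w" if "ldeg G y = 1" for y
    using that ldeg_fs_resolution_unchanged[of y E w F] ns nonsingular_iff[OF F]
    unfolding G_def by metis
  show ?thesis
  proof (cases "\<exists>x\<in>E. ldeg G x = 1")
    case True
    then obtain x where x: "x \<in> E" "ldeg G x = 1" by blast
    have "- x \<notin> E" "- x \<noteq> w" "- x \<noteq> - w" using fs' x unfolding clause_def by auto
    then have mx: "ldeg G (- x) \<noteq> 1" using deg by blast
    have "unsat_hitting (assign x G)"
      using assign_unsat_hitting[OF G] singular_literal_nonzero[OF G x(2)] by blast
    \<comment> \<open>Such a \<open>y\<close> already had degree 1 in \<open>G\<close> and differs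
      from \<open>x\<close>, the only literal of \<open>E\<close> with that degree.\<close>
    moreover have "y = w \<or> y = - w" if "ldeg (assign x G) y = 1" for y
      using singular_after_assign[OF G x(2) mx that] deg singular_literal_unique[OF G EG] x by metis
    ultimately have "singind (assign x G) \<le> 2" using singind_le_2 by blast
    then show ?thesis using singind_assign[OF G x(2)] unfolding G_def by simp
  next
    case False
    then have "singind G \<le> 2" using singind_le_2[OF G] deg by blast
    then show ?thesis unfolding G_def by simp
  qed
qed

theorem lemma8:
  fixes F F' :: "int set set"
  assumes "unsat_hitting F"
    and "nonsingular F"
    and "fs_resolvable F"
    and "fs_resolution F F'"
  shows "unsat_hitting F' \<and> singind F' \<le> 3"
  using assms fs_resolution_unsat_hitting singind_fs_resolution_le_3
  unfolding fs_resolution_def by blast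

end
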